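(* Assume the noise transition matrix is symmetric, i.e. $e_\Delta:=e_1-e_0=0$, and let $r_{\mathrm{LC}}:=\frac{2e_0}{2e_0-1}<0$. Then backward and forward loss correction are a special form of negative label smoothing with smooth rate $r_{\mathrm{LC}}$, that is, $$\min_{f\in\mathcal F}\mathbb{E}_{(X,\widetilde Y)\sim\widetilde{\mathcal D}}\big[\ell^{\leftarrow}(\mathbf f(X),\widetilde Y)\big]=\min_{f\in\mathcal F}\mathbb{E}_{(X,\widetilde Y)\sim\widetilde{\mathcal D}}\big[\ell^{\rightarrow}(\mathbf f(X),\widetilde Y)\big]=\min_{f\in\mathcal F}\mathbb{E}_{(X,\widetilde Y)\sim\widetilde{\mathcal D}}\big[\ell(\mathbf f(X),\widetilde Y^{\mathrm{GLS},r_{\mathrm{LC}}})\big].$$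
   Context: Binary classification with label noise. $(X,Y)\sim\mathcal D$ with $X\in\mathcal X$ and clean label $Y\in\{0,1\}$. The noisy label $\widetilde Y\in\{0,1\}$ is conditionally independent of $X$ given $Y$, with $\mathbb P(\widetilde Y=1\mid Y=0)=e_0$, $\mathbb P(\widetilde Y=0\mid Y=1)=e_1$. $\widetilde{\mathcal D}$ is the law of $(X,\widetilde Y)$. The noise transition matrix $T=(T_{ij})$, $T_{ij}=\mathbb P(\widetilde Y=j\mid Y=i)$, i.e. $T=\begin{pmatrix}1-e_0&e_0\\ e_1&1-e_1\end{pmatrix}$, is non-singular and known. A model $f$ assigns to each $x$ a probability vector $\mathbf f(x)=(\mathbf f(x)_0,\mathbf f(x)_1)$ (a softmax output); $\mathcal F$ is the hypothesis space of models under consideration. The loss is cross-entropy, $\ell(\mathbf f(x),y)=-\log \mathbf f(x)_y$, extended linearly to vector labels: $\ell(\mathbf f(x),\mathbf v)=-\sum_{k} v_k\log\mathbf f(x)_k$ for $\mathbf v\in\mathbb R^2$. Generalized label smoothing: for a label $y$ with one-hot vector $\mathbf y\in\mathbb R^2$ and smooth rate $r\in(-\infty,1]$, $\mathbf y^{\mathrm{GLS},r}=(1-r)\mathbf y+\frac r2\mathbf 1$ with $\mathbf 1$ the all-ones vector; $\widetilde Y^{\mathrm{GLS},r}$ is the smoothed version of $\widetilde Y$. The case $r<0$ is called negative label smoothing. Backward correction re-weights the loss by the inverse of $T$: $\ell^{\leftarrow}(\mathbf f(x),j)=\sum_{k\in\{0,1\}}(T^{-1})_{jk}\,\ell(\mathbf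 f(x),k)$. Forward correction multiplies the model predictions by the transition matrix: $\ell^{\rightarrow}(\mathbf f(x),j)=\ell(T^{\top}\mathbf f(x),j)=-\log\big((T^\top\mathbf f(x))_j\big)$.
   Formalization: The minimal value for forward correction differs in general from the other two, so for the forward term the equality is proved for sets of minimizers instead of minimal values, assuming F contains the clean posterior P(Y|X); backward = GLS is proved as stated. Expectations are assumed to exist. *)

theory Defs
  imports "HOL-Probability.Probability"
begin

text \<open>Labels are the elements \<open>0\<close> and \<open>1\<close> of the two-element type \<open>2\<close>, which also indexes
  the vectors in \<open>real ^ 2\<close> and the rows (clean label) and columns (noisy label) of
  the noise transition matrix.\<close>

definition noise_matrix :: "real \<Rightarrow> real \<Rightarrow> real ^ 2 ^ 2" where
  "noise_matrix e0 e1 =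
     (\<chi> i j. if i = 0 then (if j = 0 then 1 - e0 else e0)
                        else (if j = 0 then e1 else 1 - e1))"

text \<open>The transition rates are only prescribed for clean labels of positive probability,
  since otherwise the conditional probability is not defined.  Conditional independence of
  \<open>X\<close> and \<open>Yt\<close> given \<open>Y\<close>, that is, \<open>P(X \<in> A, Yt = j | Y = i) = P(X \<in> A | Y = i) P(Yt = j | Y = i)\<close>,
  is stated with the denominators \<open>P(Y = i)\<close> cleared.\<close>

locale label_noise = prob_space M for M :: "'w measure" +
  fixes MX :: "'x measure" and X :: "'w \<Rightarrow> 'x"
    and Y Yt :: "'w \<Rightarrow> 2" and e0 e1 :: real
  assumes X_measurable: "X \<in> M \<rightarrow>\<^sub>M MX"
    and Y_measurable: "Y \<in> M \<rightarrow>\<^sub>M count_space UNIV"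
    and Yt_measurable: "Yt \<in> M \<rightarrow>\<^sub>M count_space UNIV"
    and rates: "0 \<le> e0" "e0 \<le> 1" "0 \<le> e1" "e1 \<le> 1"
    and transition: "\<And>i j. \<P>(\<omega> in M. Y \<omega> = i) > 0 \<Longrightarrow>
          \<P>(\<omega> in M. Yt \<omega> = j \<bar> Y \<omega> = i) = noise_matrix e0 e1 $ i $ j"
    and cond_indep: "\<And>A i j. A \<in> sets MX \<Longrightarrow>
          \<P>(\<omega> in M. X \<omega> \<in> A \<and> Yt \<omega> = j \<and> Y \<omega> = i) * \<P>(\<omega> in M. Y \<omega> = i) =
          \<P>(\<omega> in M. X \<omega> \<in> A \<and> Y \<omega> = i) * \<P>(\<omega> in M. Yt \<omega> = j \<and> Y \<omega> = i)"

text \<open>The law of \<open>(X, Yt)\<close>.\<close>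

definition noisy_law ::
  "'w measure \<Rightarrow> 'x measure \<Rightarrow> ('w \<Rightarrow> 'x) \<Rightarrow> ('w \<Rightarrow> 2) \<Rightarrow> ('x \<times> 2) measure" where
  "noisy_law M MX X Yt = distr M (MX \<Otimes>\<^sub>M count_space UNIV) (\<lambda>\<omega>. (X \<omega>, Yt \<omega>))"

text \<open>Softmax outputs are strictly positive, so no logarithm of zero ever occurs.\<close>

definition softmax_model :: "'x measure \<Rightarrow> ('x \<Rightarrow> real ^ 2) \<Rightarrow> bool" where
  "softmax_model MX f \<longleftrightarrow> f \<in> borel_measurable MX \<and>
     (\<forall>x\<in>space MX. (\<forall>k. f x $ k > 0) \<and> (\<Sum>k\<in>UNIV. f x $ k) = 1)"

definition ce_loss :: "real ^ 2 \<Rightarrow> 2 \<Rightarrow> real" where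
  "ce_loss p y = - ln (p $ y)"

definition ce_loss_vec :: "real ^ 2 \<Rightarrow> real ^ 2 \<Rightarrow> real" where
  "ce_loss_vec p v = - (\<Sum>k\<in>UNIV. v $ k * ln (p $ k))"

definition gls :: "real \<Rightarrow> 2 \<Rightarrow> real ^ 2" where
  "gls r y = (1 - r) *\<^sub>R axis y 1 + (r / 2) *\<^sub>R vec 1"

definition gls_loss :: "real \<Rightarrow> real ^ 2 \<Rightarrow> 2 \<Rightarrow> real" where
  "gls_loss r p y = ce_loss_vec p (gls r y)"

definition backward_loss :: "real ^ 2 ^ 2 \<Rightarrow> real ^ 2 \<Rightarrow> 2 \<Rightarrow> real" where
  "backward_loss T p j = (\<Sum>k\<in>UNIV. matrix_inv T $ j $ k * ce_loss p k)"

definition forward_loss :: "real ^ 2 ^ 2 \<Rightarrow> real ^ 2 \<Rightarrow> 2 \<Rightarrow> real" where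
  "forward_loss T p j = ce_loss (transpose T *v p) j"

definition risk :: "('x \<times> 2) measure \<Rightarrow> (real ^ 2 \<Rightarrow> 2 \<Rightarrow> real) \<Rightarrow> ('x \<Rightarrow> real ^ 2) \<Rightarrow> real" where
  "risk D L f = (LINT (x, y)|D. L (f x) y)"

definition minimizers :: "('x \<times> 2) measure \<Rightarrow> (real ^ 2 \<Rightarrow> 2 \<Rightarrow> real) \<Rightarrow>
    ('x \<Rightarrow> real ^ 2) set \<Rightarrow> ('x \<Rightarrow> real ^ 2) set" where
  "minimizers D L F = {f. is_arg_min (risk D L) (\<lambda>g. g \<in> F) f}"

text \<open>\<open>g x $ k\<close> is a version of the clean conditional probability \<open>P(Y = k | X = x)\<close>.\<close>

definition clean_posterior :: "'w measure \<Rightarrow> 'x measure \<Rightarrow> ('w \<Rightarrow> 'x) \<Rightarrow> ('w \<Rightarrow> 2) \<Rightarrow>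
    ('x \<Rightarrow> real ^ 2) \<Rightarrow> bool" where
  "clean_posterior M MX X Y g \<longleftrightarrow> (\<forall>k. \<forall>A\<in>sets MX.
     \<P>(\<omega> in M. X \<omega> \<in> A \<and> Y \<omega> = k) = (LINT x:A|distr M MX X. g x $ k))"

end

theory Submission
  imports Defs
begin

text \<open>A symmetric transition matrix with rate \<open>e\<close> is inverted by the one with rate
  \<open>e / (2e - 1) = r / 2\<close>, whose rows are exactly the smoothed labels; hence the backward
  loss and the smoothed loss coincide pointwise.

  If \<open>g\<close> is the clean posterior, then \<open>g v* T\<close> is the noisy one.  Disintegrating the noisy law
  along \<open>X\<close> turns the backward risk of \<open>f\<close> into the expected cross-entropy of \<open>f\<close> relative to \<open>g\<close>, and the forward risk into
  that of \<open>f v* T\<close> relative to \<open>g v* T\<close>.  By the equality case of Gibbs' inequality both are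
  minimized exactly by the models that agree with \<open>g\<close> almost everywhere.\<close>

section \<open>Labels in the two-element type and their smoothing\<close>

lemma zero_eq_two: "(0::2) = 2"
  by simp

lemma two_cases: "(j::2) = 0 \<or> j = 1"
  \<comment> \<open>\<open>exhaust_2\<close> enumerates the type as 1 and 2; arithmetic is modulo 2,
    so its 2 is the label 0.\<close>
  using exhaust_2[of j] zero_eq_two by metis

lemma all_two: "(\<forall>j::2. P j) \<longleftrightarrow> P 0 \<and> P 1"
  using two_cases by metis

lemma sum_two: "(\<Sum>k\<in>(UNIV::2 set). h k) = h 0 + h 1"
  using sum_2[of h] zero_eq_two by (metis add.commute)

text \<open>Smoothing puts mass r/2 off the diagonal and 1 - r + r/2 = 1 - r/2 on it, the pattern of
  a symmetric transition matrix with rate r/2. For r < 0 this rate is negative, so the matrix is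
  then not stochastic.\<close>

lemma gls_nth: "gls r y $ k = noise_matrix (r / 2) (r / 2) $ y $ k"
  using two_cases[of y] two_cases[of k]
  by (auto simp: gls_def noise_matrix_def axis_def vec_def)

section \<open>Inverting a symmetric transition matrix\<close>

lemma matrix_inv_inverse:
  assumes "invertible A"
  shows "A ** matrix_inv A = mat 1" "matrix_inv A ** A = mat 1"
  using someI_ex[OF assms[unfolded invertible_def]] unfolding matrix_inv_def by auto

lemma matrix_inv_unique:
  assumes "A ** B = mat 1" "B ** A = mat 1"
  shows "matrix_inv A = B"
proof -
  have "matrix_inv A ** A = mat 1"
    using assms by (intro matrix_inv_inverse) (auto simp: invertible_def)
  then show ?thesis
    by (metis assms(1) matrix_mul_assoc matrix_mul_lid matrix_mul_rid)
qed

text \<open>Two independent symmetric flips amount to one symmetric flip, which occurs when exactly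
  one of them does: a (1 - b) + b (1 - a). As a polynomial identity this also holds for rates
  outside [0, 1].\<close>

lemma noise_matrix_mult:
  "noise_matrix a a ** noise_matrix b b = noise_matrix (a + b - 2 * a * b) (a + b - 2 * a * b)"
  by (simp add: vec_eq_iff all_two matrix_matrix_mult_def sum_two noise_matrix_def algebra_simps)

lemma noise_matrix_0: "noise_matrix 0 0 = mat 1"
  by (simp add: vec_eq_iff all_two noise_matrix_def mat_def)

lemma gls_loss_eq_backward_loss:
  assumes "e \<noteq> 1 / 2" "r = 2 * e / (2 * e - 1)"
  shows "gls_loss r = backward_loss (noise_matrix e e)"
proof -
  have "2 * e - 1 \<noteq> 0" using assms(1) by auto
  \<comment> \<open>The number r/2 = e/(2e - 1) is the rate b that solves e + b - 2eb = 0, so that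
    the composed flip has rate 0.\<close>
  then have "e + r / 2 - 2 * e * (r / 2) = 0" "r / 2 + e - 2 * (r / 2) * e = 0"
    unfolding assms(2) by (simp_all add: divide_simps) (simp_all add: algebra_simps)
  then have "noise_matrix e e ** noise_matrix (r / 2) (r / 2) = mat 1"
    "noise_matrix (r / 2) (r / 2) ** noise_matrix e e = mat 1"
    unfolding noise_matrix_mult by (simp_all only: noise_matrix_0)
  then have "matrix_inv (noise_matrix e e) = noise_matrix (r / 2) (r / 2)"
    by (rule matrix_inv_unique)
  then show ?thesis
    by (auto simp: fun_eq_iff gls_loss_def backward_loss_def ce_loss_vec_def ce_loss_def gls_nth
        sum_negf)
qed

section \<open>Gibbs' inequality with its equality case\<close>

lemma gibbs_inequality:
  fixes p q :: "real ^ 'n::finite"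
  assumes p: "\<And>k. p $ k > 0" and q: "\<And>k. q $ k > 0"
    and sums: "(\<Sum>k\<in>UNIV. p $ k) = (\<Sum>k\<in>UNIV. q $ k)"
  shows "(\<Sum>k\<in>UNIV. q $ k * - ln (q $ k)) \<le> (\<Sum>k\<in>UNIV. q $ k * - ln (p $ k))"
    and "(\<Sum>k\<in>UNIV. q $ k * - ln (q $ k)) = (\<Sum>k\<in>UNIV. q $ k * - ln (p $ k)) \<longleftrightarrow> p = q"
proof -
  \<comment> \<open>The gap between cross-entropy and entropy is regrouped by adding p - q, whose
    components sum to 0. Each term is then nonnegative by ln t \<le> t - 1 at t = p/q, and it
    vanishes only for t = 1.\<close>
  define d where "d k = q $ k * ((p $ k / q $ k - 1) - ln (p $ k / q $ k))" for k
  have d_nonneg: "d k \<ge> 0" for k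
    unfolding d_def using ln_le_minus_one[of "p $ k / q $ k"] p[of k] q[of k] by simp
  have "d k = p $ k - q $ k + (q $ k * - ln (p $ k) - q $ k * - ln (q $ k))" for k
    unfolding d_def using p[of k] q[of k] by (simp add: ln_div field_simps)
  then have sum_d: "sum d UNIV =
      (\<Sum>k\<in>UNIV. q $ k * - ln (p $ k)) - (\<Sum>k\<in>UNIV. q $ k * - ln (q $ k))"
    using sums by (simp add: sum.distrib sum_subtractf sum_negf)
  show "(\<Sum>k\<in>UNIV. q $ k * - ln (q $ k)) \<le> (\<Sum>k\<in>UNIV. q $ k * - ln (p $ k))"
    using sum_d sum_nonneg[of UNIV d] d_nonneg by simp
  have "p = q" if "sum d UNIV = 0"
  proof -
    have "p $ k = q $ k" for k
    proof -
      have "d k = 0" using that d_nonneg by (simp add: sum_nonneg_eq_0_iff)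
      then have "ln (p $ k / q $ k) = p $ k / q $ k - 1"
        using q[of k] by (auto simp: d_def)
      then have "p $ k / q $ k = 1" using p[of k] q[of k] by (intro ln_eq_minus_one) auto
      then show ?thesis by simp
    qed
    then show ?thesis by (simp add: vec_eq_iff)
  qed
  then show "(\<Sum>k\<in>UNIV. q $ k * - ln (q $ k)) = (\<Sum>k\<in>UNIV. q $ k * - ln (p $ k)) \<longleftrightarrow> p = q"
    using sum_d by (metis diff_eq_eq add_0)
qed

section \<open>Softmax models and the minimizers of an expected cross-entropy\<close>

lemma softmax_modelD:
  assumes "softmax_model N f"
  shows "f \<in> borel_measurable N" "x \<in> space N \<Longrightarrow> f x $ k > 0"
    "x \<in> space N \<Longrightarrow> (\<Sum>k\<in>UNIV. f x $ k) = 1" "x \<in> space N \<Longrightarrow> f x $ k \<le> 1"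
    "(\<lambda>x. f x $ k) \<in> borel_measurable N"
proof -
  show *: "f \<in> borel_measurable N" "x \<in> space N \<Longrightarrow> f x $ k > 0"
    "x \<in> space N \<Longrightarrow> (\<Sum>k\<in>UNIV. f x $ k) = 1" for k
    using assms by (auto simp: softmax_model_def)
  show "(\<lambda>x. f x $ k) \<in> borel_measurable N"
    using *(1) by (rule borel_measurable_continuous_on[rotated]) (intro continuous_intros)
  show "x \<in> space N \<Longrightarrow> f x $ k \<le> 1"
    using *(2)[of 0] *(2)[of 1] *(3) two_cases[of k] by (auto simp: sum_two)
qed

lemma softmax_ce_loss_measurable:
  assumes "softmax_model N f"
  shows "(\<lambda>x. ce_loss (f x) k) \<in> borel_measurable N"
  unfolding ce_loss_def using softmax_modelD(5)[OF assms, of k] by measurable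

text \<open>The weights of a softmax model lie in (0, 1], so \<open>h\<close> itself is an
  integrable bound.\<close>

lemma integrable_softmax_mult:
  assumes "softmax_model N q" "integrable N h"
  shows "integrable N (\<lambda>x. q x $ k * h x)"
proof (rule Bochner_Integration.integrable_bound[OF assms(2)])
  show "(\<lambda>x. q x $ k * h x) \<in> borel_measurable N"
    using softmax_modelD(5)[OF assms(1), of k] borel_measurable_integrable[OF assms(2)] by measurable
  show "AE x in N. norm (q x $ k * h x) \<le> norm (h x)"
    using softmax_modelD(2,4)[OF assms(1)]
    by (intro AE_I2) (auto simp: abs_mult less_imp_le intro!: mult_left_le_one_le)
qed

text \<open>By Gibbs' inequality the integrand of \<open>f\<close> is pointwise at least that of
  \<open>g\<close>, so \<open>g\<close> is a minimizer; any other minimizer has a nonnegative excess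
  of integral 0, hence one that vanishes almost everywhere. The map \<open>u\<close> lets one lemma
  serve both corrections: it is the identity for the backward loss and multiplication by the
  transition matrix for the forward loss.\<close>

lemma minimizers_cross_entropy:
  fixes u :: "real ^ 2 \<Rightarrow> real ^ 2"
  assumes g: "g \<in> F"
    and models: "\<And>f. f \<in> F \<Longrightarrow> softmax_model N (\<lambda>x. u (f x))"
    and int: "\<And>f k. f \<in> F \<Longrightarrow> integrable N (\<lambda>x. ce_loss (u (f x)) k)"
    and risk: "\<And>f. f \<in> F \<Longrightarrow>
      risk D L f = (LINT x|N. (\<Sum>k\<in>UNIV. u (g x) $ k * ce_loss (u (f x)) k))"
  shows "minimizers D L F = {f \<in> F. AE x in N. u (f x) = u (g x)}"
proof -
  define c where "c f x = (\<Sum>k\<in>UNIV. u (g x) $ k * ce_loss (u (f x)) k)" for f x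
  have c_int: "integrable N (c f)" if "f \<in> F" for f
    unfolding c_def using int[OF that] models[OF g]
    by (intro Bochner_Integration.integrable_sum integrable_softmax_mult[where q = "\<lambda>x. u (g x)"])
  have le: "c g x \<le> c f x" and eq: "c f x = c g x \<longleftrightarrow> u (f x) = u (g x)"
    if "f \<in> F" "x \<in> space N" for f x
    using gibbs_inequality[of "u (f x)" "u (g x)",
        OF softmax_modelD(2)[OF models[OF that(1)] that(2)] softmax_modelD(2)[OF models[OF g] that(2)]
          trans[OF softmax_modelD(3)[OF models[OF that(1)] that(2)]
            softmax_modelD(3)[OF models[OF g] that(2), symmetric]]]
    unfolding c_def ce_loss_def by metis+
  have risk_c: "risk D L f = integral\<^sup>L N (c f)" if "f \<in> F" for f
    unfolding c_def using risk[OF that] .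
  have g_min: "risk D L g \<le> risk D L f" if "f \<in> F" for f
    unfolding risk_c[OF that] risk_c[OF g]
    using that c_int g le by (intro integral_mono) auto
  have risk_eq: "risk D L f = risk D L g \<longleftrightarrow> (AE x in N. u (f x) = u (g x))" if f: "f \<in> F" for f
  proof -
    have "risk D L f = risk D L g \<longleftrightarrow> (LINT x|N. c f x - c g x) = 0"
      using c_int[OF f] c_int[OF g] risk_c[OF f] risk_c[OF g] by simp
    also have "\<dots> \<longleftrightarrow> (AE x in N. c f x - c g x = 0)"
      using c_int[OF f] c_int[OF g] le[OF f]
      by (intro integral_nonneg_eq_0_iff_AE) auto
    also have "\<dots> \<longleftrightarrow> (AE x in N. u (f x) = u (g x))"
      using eq[OF f] by (intro AE_cong) auto
    finally show ?thesis .
  qed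
  \<comment> \<open>Since \<open>g\<close> attains the minimum, the minimizers are the members of
    \<open>F\<close> with the same risk as \<open>g\<close>.\<close>
  show ?thesis
    using g g_min risk_eq unfolding minimizers_def is_arg_min_linorder
    by (auto simp: dual_order.antisym) (metis dual_order.antisym)+
qed

text \<open>The rows of the matrix sum to 1, so total mass is preserved, and each component becomes
  e + (1 - 2e) times the old one. The uniform lower bound \<open>e\<close> is what later yields
  integrability: of the loss at each fixed label, and of the forward loss.\<close>

lemma softmax_model_transition:
  assumes f: "softmax_model MX f" and e: "0 < e" "e < 1 / 2"
  shows "softmax_model MX (\<lambda>x. f x v* noise_matrix e e)"
    and "x \<in> space MX \<Longrightarrow> e \<le> (f x v* noise_matrix e e) $ j"
proof -
  let ?q = "\<lambda>x. f x v* noise_matrix e e"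
  have q: "?q x $ 0 = (1 - e) * f x $ 0 + e * f x $ 1"
    "?q x $ 1 = e * f x $ 0 + (1 - e) * f x $ 1" for x
    by (auto simp: vector_matrix_mult_def sum_two noise_matrix_def algebra_simps)
  have ge: "e \<le> ?q x $ j" if "x \<in> space MX" for x j
  proof -
    have "f x $ 0 + f x $ 1 = 1" "f x $ 0 > 0" "f x $ 1 > 0"
      using softmax_modelD(2,3)[OF f that] by (auto simp: sum_two)
    then have "?q x $ 0 = e + (1 - 2 * e) * f x $ 0" "?q x $ 1 = e + (1 - 2 * e) * f x $ 1"
      unfolding q by (simp_all add: algebra_simps add_eq_0_iff) algebra+
    then show ?thesis
      using two_cases[of j] e \<open>f x $ 0 > 0\<close> \<open>f x $ 1 > 0\<close> by auto
  qed
  then show "x \<in> space MX \<Longrightarrow> e \<le> ?q x $ j" .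
  have "?q x $ 0 + ?q x $ 1 = f x $ 0 + f x $ 1" for x
    unfolding q by (simp add: algebra_simps)
  moreover have "?q \<in> borel_measurable MX"
    using softmax_modelD(1)[OF f]
    by (rule borel_measurable_continuous_on[rotated])
       (auto simp flip: transpose_matrix_vector intro: matrix_vector_mult_linear_continuous_on)
  ultimately show "softmax_model MX ?q"
    using ge e(1) softmax_modelD(3)[OF f] unfolding softmax_model_def
    by (auto simp: sum_two intro: less_le_trans)
qed

section \<open>Disintegration of the noisy law along \<open>X\<close>\<close>

context label_noise
begin

abbreviation PX :: "'x measure" where "PX \<equiv> distr M MX X"

text \<open>This is the law of total probability over the clean label, where conditional
  independence lets the transition rate factor out of each term.\<close>

lemma noisy_joint:
  assumes A: "A \<in> sets MX"
  shows "\<P>(\<omega> in M. X \<omega> \<in> A \<and> Yt \<omega> = j) =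
    (\<Sum>i\<in>UNIV. noise_matrix e0 e1 $ i $ j * \<P>(\<omega> in M. X \<omega> \<in> A \<and> Y \<omega> = i))"
proof -
  note [measurable] = X_measurable Y_measurable Yt_measurable A
  have *: "\<P>(\<omega> in M. X \<omega> \<in> A \<and> Yt \<omega> = j \<and> Y \<omega> = i) =
      noise_matrix e0 e1 $ i $ j * \<P>(\<omega> in M. X \<omega> \<in> A \<and> Y \<omega> = i)" for i
  proof (cases "\<P>(\<omega> in M. Y \<omega> = i) > 0")
    case True
    then show ?thesis
      using transition[OF True, of j] cond_indep[OF A, of j i]
      by (simp add: cond_prob_def field_simps)
  next
    \<comment> \<open>For a clean label of probability 0 no rates are prescribed, but both joint
      probabilities are then 0.\<close>
    case False
    then have 0: "\<P>(\<omega> in M. Y \<omega> = i) = 0"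
      using measure_nonneg[of M] by (simp add: not_less order_antisym)
    have "\<P>(\<omega> in M. X \<omega> \<in> A \<and> Yt \<omega> = j \<and> Y \<omega> = i) \<le> \<P>(\<omega> in M. Y \<omega> = i)"
      "\<P>(\<omega> in M. X \<omega> \<in> A \<and> Y \<omega> = i) \<le> \<P>(\<omega> in M. Y \<omega> = i)"
      by (intro finite_measure_mono; force)+
    then show ?thesis using 0 by (simp add: measure_le_0_iff)
  qed
  have "\<P>(\<omega> in M. X \<omega> \<in> A \<and> Yt \<omega> = j) =
      measure M (\<Union>i\<in>UNIV. {\<omega> \<in> space M. X \<omega> \<in> A \<and> Yt \<omega> = j \<and> Y \<omega> = i})"
    by (rule arg_cong[where f = "measure M"]) auto
  also have "\<dots> = (\<Sum>i\<in>UNIV. \<P>(\<omega> in M. X \<omega> \<in> A \<and> Yt \<omega> = j \<and> Y \<omega> = i))"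
    by (rule finite_measure_finite_Union) (auto simp: disjoint_family_on_def)
  finally show ?thesis by (simp add: *)
qed

text \<open>Both measures assign to \<open>A\<close> the probability of X \<in> A and Yt = j: on the
  left, column j of the matrix mixes the integrals of the clean posterior exactly as in
  \<open>noisy_joint\<close>. Thus \<open>g v* noise_matrix e0 e1\<close> is the noisy
  posterior.\<close>

lemma noisy_posterior_density:
  assumes g: "softmax_model MX g" "clean_posterior M MX X Y g"
    and q: "softmax_model MX (\<lambda>x. g x v* noise_matrix e0 e1)"
  shows "density PX (\<lambda>x. ennreal ((g x v* noise_matrix e0 e1) $ j)) =
    distr (density M (indicator {\<omega> \<in> space M. Yt \<omega> = j})) MX X"
proof (rule measure_eqI)
  note [measurable] = X_measurable Y_measurable Yt_measurable
  let ?q = "\<lambda>x. g x v* noise_matrix e0 e1"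
  interpret PX: prob_space PX by (rule prob_space_distr) measurable
  have PXm: "softmax_model PX h" if "softmax_model MX h" for h
    using that by (auto simp: softmax_model_def)
  have [measurable]: "(\<lambda>x. ?q x $ j) \<in> borel_measurable MX"
    using softmax_modelD(5)[OF q] .
  fix A assume "A \<in> sets (density PX (\<lambda>x. ennreal (?q x $ j)))"
  then have A[measurable]: "A \<in> sets MX" by simp
  have int1: "integrable PX (\<lambda>x. h x $ i * indicator A x)" if "softmax_model MX h" for h i
    using PXm[OF that]
    by (intro integrable_softmax_mult)
      (auto intro: integrable_real_indicator simp: PX.emeasure_finite less_top[symmetric])
  have "emeasure (density PX (\<lambda>x. ennreal (?q x $ j))) A =
      (\<integral>\<^sup>+x. ennreal (?q x $ j * indicator A x) \<partial>PX)"
    by (subst emeasure_density) (auto intro!: nn_integral_cong split: split_indicator)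
  also have "\<dots> = ennreal (LINT x|PX. ?q x $ j * indicator A x)"
    using softmax_modelD(2)[OF q]
    by (intro nn_integral_eq_integral int1[OF q] AE_I2) (auto simp: less_imp_le)
  also have "(LINT x|PX. ?q x $ j * indicator A x) =
      (LINT x|PX. (\<Sum>i\<in>UNIV. noise_matrix e0 e1 $ i $ j * (g x $ i * indicator A x)))"
    by (intro Bochner_Integration.integral_cong)
      (simp_all only: vector_matrix_mult_def vec_lambda_beta sum_distrib_left sum_distrib_right mult_ac)
  also have "\<dots> = (\<Sum>i\<in>UNIV. noise_matrix e0 e1 $ i $ j * (LINT x|PX. g x $ i * indicator A x))"
    using int1[OF g(1)] by (subst Bochner_Integration.integral_sum) auto
  also have "\<dots> = \<P>(\<omega> in M. X \<omega> \<in> A \<and> Yt \<omega> = j)"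
    using g(2) A unfolding noisy_joint[OF A] clean_posterior_def
    by (simp add: set_lebesgue_integral_def mult.commute)
  also have "ennreal \<dots> = emeasure (distr (density M (indicator {\<omega> \<in> space M. Yt \<omega> = j})) MX X) A"
    by (subst emeasure_distr, simp, simp, subst emeasure_density)
       (auto simp: emeasure_eq_measure[symmetric] indicator_inter_arith[symmetric]
         intro!: arg_cong[where f = "emeasure M"])
  finally show "emeasure (density PX (\<lambda>x. ennreal (?q x $ j))) A =
    emeasure (distr (density M (indicator {\<omega> \<in> space M. Yt \<omega> = j})) MX X) A" .
qed simp

text \<open>The sample space is sliced by the noisy label. On the slice with label j the integrand
  depends on \<open>X\<close> alone, and the law of \<open>X\<close> restricted to that slice has
  the noisy posterior of j as its density.\<close>

lemma noisy_law_integral: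
  fixes h :: "'x \<Rightarrow> 2 \<Rightarrow> real"
  assumes g: "softmax_model MX g" "clean_posterior M MX X Y g"
    and q: "softmax_model MX (\<lambda>x. g x v* noise_matrix e0 e1)" (is "softmax_model _ ?q")
    and h[measurable]: "\<And>j. (\<lambda>x. h x j) \<in> borel_measurable MX"
  shows "integrable (noisy_law M MX X Yt) (\<lambda>(x, y). h x y) \<longleftrightarrow>
      (\<forall>j. integrable PX (\<lambda>x. ?q x $ j * h x j))" (is ?I)
    and "(\<And>j. integrable PX (\<lambda>x. ?q x $ j * h x j)) \<Longrightarrow>
      (LINT (x, y)|noisy_law M MX X Yt. h x y) = (LINT x|PX. (\<Sum>j\<in>UNIV. ?q x $ j * h x j))"
proof -
  note [measurable] = X_measurable Y_measurable Yt_measurable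
  let ?S = "\<lambda>j. {\<omega> \<in> space M. Yt \<omega> = j}"
  have [measurable]: "(\<lambda>x. ?q x $ j) \<in> borel_measurable MX" for j
    using softmax_modelD(5)[OF q] .
  have q_nonneg: "AE x in PX. 0 \<le> ?q x $ j" for j
    using softmax_modelD(2)[OF q] by (intro AE_I2) (auto simp: less_imp_le)
  have [measurable]: "(\<lambda>(x, y). h x y) \<in> borel_measurable (MX \<Otimes>\<^sub>M count_space UNIV)"
    by measurable
  \<comment> \<open>The integration rules for densities expect a real function coerced by
    \<open>ennreal\<close>, not an indicator with values in \<open>ennreal\<close>.\<close>
  have dens: "density M (indicator (?S j)) = density M (\<lambda>\<omega>. ennreal (indicator (?S j) \<omega>))" for j
    by (simp add: ennreal_indicator)
  note nd = noisy_posterior_density[OF g q, unfolded dens]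
  have int_j: "integrable PX (\<lambda>x. ?q x $ j * h x j) \<longleftrightarrow>
      integrable M (\<lambda>\<omega>. indicator (?S j) \<omega> * h (X \<omega>) (Yt \<omega>))" for j
  proof -
    have "integrable PX (\<lambda>x. ?q x $ j * h x j) \<longleftrightarrow>
        integrable (density PX (\<lambda>x. ennreal (?q x $ j))) (\<lambda>x. h x j)"
      using q_nonneg by (subst integrable_density) auto
    also have "\<dots> \<longleftrightarrow> integrable M (\<lambda>\<omega>. indicator (?S j) \<omega> * h (X \<omega>) j)"
      unfolding nd by (subst integrable_distr_eq, simp, simp, subst integrable_density) auto
    \<comment> \<open>Where the indicator is nonzero the noisy label is \<open>j\<close>. Writing
      \<open>Yt \<omega>\<close> instead gives all slices the same integrand, so that they add up to
      it.\<close>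
    also have "(\<lambda>\<omega>. indicator (?S j) \<omega> * h (X \<omega>) j) = (\<lambda>\<omega>. indicator (?S j) \<omega> * h (X \<omega>) (Yt \<omega>))"
      by (auto simp: fun_eq_iff split: split_indicator)
    finally show ?thesis .
  qed
  have eq_j: "(LINT x|PX. ?q x $ j * h x j) = (LINT \<omega>|M. indicator (?S j) \<omega> * h (X \<omega>) (Yt \<omega>))" for j
  proof -
    have "(LINT x|PX. ?q x $ j * h x j) = (LINT x|density PX (\<lambda>x. ennreal (?q x $ j)). h x j)"
      using q_nonneg by (subst integral_density) auto
    also have "\<dots> = (LINT \<omega>|M. indicator (?S j) \<omega> * h (X \<omega>) j)"
      unfolding nd by (subst integral_distr, simp, simp, subst integral_density) auto
    also have "(\<lambda>\<omega>. indicator (?S j) \<omega> * h (X \<omega>) j) = (\<lambda>\<omega>. indicator (?S j) \<omega> * h (X \<omega>) (Yt \<omega>))"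
      by (auto simp: fun_eq_iff split: split_indicator)
    finally show ?thesis .
  qed
  have split: "(\<Sum>j\<in>UNIV. indicator (?S j) \<omega> * h (X \<omega>) (Yt \<omega>)) = h (X \<omega>) (Yt \<omega>)"
    if "\<omega> \<in> space M" for \<omega>
  proof -
    have "(\<Sum>j\<in>UNIV. indicator (?S j) \<omega> * h (X \<omega>) (Yt \<omega>)) =
        (\<Sum>j\<in>UNIV. if Yt \<omega> = j then h (X \<omega>) (Yt \<omega>) else 0)"
      using that by (intro sum.cong) auto
    then show ?thesis by simp
  qed
  have "integrable (noisy_law M MX X Yt) (\<lambda>(x, y). h x y) \<longleftrightarrow>
      integrable M (\<lambda>\<omega>. h (X \<omega>) (Yt \<omega>))"
    unfolding noisy_law_def by (subst integrable_distr_eq) auto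
  also have "\<dots> \<longleftrightarrow> (\<forall>j. integrable M (\<lambda>\<omega>. indicator (?S j) \<omega> * h (X \<omega>) (Yt \<omega>)))"
  proof safe
    fix j assume "integrable M (\<lambda>\<omega>. h (X \<omega>) (Yt \<omega>))"
    then show "integrable M (\<lambda>\<omega>. indicator (?S j) \<omega> * h (X \<omega>) (Yt \<omega>))"
      using integrable_mult_indicator[of "?S j" M "\<lambda>\<omega>. h (X \<omega>) (Yt \<omega>)"] by simp
  next
    assume "\<forall>j. integrable M (\<lambda>\<omega>. indicator (?S j) \<omega> * h (X \<omega>) (Yt \<omega>))"
    then have "integrable M (\<lambda>\<omega>. \<Sum>j\<in>UNIV. indicator (?S j) \<omega> * h (X \<omega>) (Yt \<omega>))"
      by (intro Bochner_Integration.integrable_sum) blast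
    moreover have "integrable M (\<lambda>\<omega>. \<Sum>j\<in>UNIV. indicator (?S j) \<omega> * h (X \<omega>) (Yt \<omega>)) \<longleftrightarrow>
        integrable M (\<lambda>\<omega>. h (X \<omega>) (Yt \<omega>))"
      by (rule Bochner_Integration.integrable_cong) (simp_all only: split)
    ultimately show "integrable M (\<lambda>\<omega>. h (X \<omega>) (Yt \<omega>))"
      by (rule iffD1[rotated])
  qed
  finally show ?I using int_j by simp
  assume *: "\<And>j. integrable PX (\<lambda>x. ?q x $ j * h x j)"
  have "(LINT (x, y)|noisy_law M MX X Yt. h x y) = (LINT \<omega>|M. h (X \<omega>) (Yt \<omega>))"
    unfolding noisy_law_def by (subst integral_distr) auto
  also have "\<dots> = (LINT \<omega>|M. (\<Sum>j\<in>UNIV. indicator (?S j) \<omega> * h (X \<omega>) (Yt \<omega>)))"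
    by (rule Bochner_Integration.integral_cong) (simp_all only: split)
  also have "\<dots> = (\<Sum>j\<in>UNIV. (LINT x|PX. ?q x $ j * h x j))"
    unfolding eq_j using * int_j by (intro Bochner_Integration.integral_sum) auto
  also have "\<dots> = (LINT x|PX. (\<Sum>j\<in>UNIV. ?q x $ j * h x j))"
    using * by (subst Bochner_Integration.integral_sum) auto
  finally show "(LINT (x, y)|noisy_law M MX X Yt. h x y) =
    (LINT x|PX. (\<Sum>j\<in>UNIV. ?q x $ j * h x j))" .
qed

section \<open>Minimizers of the backward and the forward risk\<close>

lemma minimizers_symmetric_noise:
  assumes e: "0 < e" "e < 1 / 2" "e0 = e" "e1 = e"
    and models: "\<And>f. f \<in> F \<Longrightarrow> softmax_model MX f"
    and int: "\<And>f. f \<in> F \<Longrightarrow> integrable (noisy_law M MX X Yt) (\<lambda>(x, y). ce_loss (f x) y)"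
    and g: "g \<in> F" "clean_posterior M MX X Y g"
    and inv: "invertible (noise_matrix e e)"
  shows "minimizers (noisy_law M MX X Yt) (backward_loss (noise_matrix e e)) F =
      {f \<in> F. AE x in PX. f x = g x}"
    and "minimizers (noisy_law M MX X Yt) (forward_loss (noise_matrix e e)) F =
      {f \<in> F. AE x in PX. f x = g x}"
proof -
  let ?T = "noise_matrix e e" and ?D = "noisy_law M MX X Yt"
  let ?u = "\<lambda>p. p v* noise_matrix e e"
  note [measurable] = X_measurable
  interpret PX: prob_space PX by (rule prob_space_distr) measurable
  have PXm: "softmax_model PX h" if "softmax_model MX h" for h
    using that by (auto simp: softmax_model_def)
  have sm: "softmax_model MX (\<lambda>x. ?u (f x))" if "f \<in> F" for f
    using softmax_model_transition(1)[OF models[OF that] e(1,2)] .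
  have ge: "e \<le> ?u (f x) $ j" if "f \<in> F" "x \<in> space MX" for f x j
    using softmax_model_transition(2)[OF models[OF that(1)] e(1,2) that(2)] .
  note law = noisy_law_integral[OF models[OF g(1)] g(2), unfolded e(3,4), OF sm[OF g(1)]]
  have qint: "integrable PX (\<lambda>x. ?u (g x) $ j * h x)" if "integrable PX h" for h j
    using PXm[OF sm[OF g(1)]] that by (rule integrable_softmax_mult)

  \<comment> \<open>The noisy posterior is at least \<open>e > 0\<close>, so integrability under the noisy law forces
    integrability of the loss for each fixed label.\<close>
  have ce_int: "integrable PX (\<lambda>x. ce_loss (f x) k)" if f: "f \<in> F" for f k
  proof (rule Bochner_Integration.integrable_bound)
    have m: "(\<lambda>x. ce_loss (f x) j) \<in> borel_measurable MX" for j
      using softmax_ce_loss_measurable[OF models[OF f]] .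
    show "integrable PX (\<lambda>x. (?u (g x) $ k * ce_loss (f x) k) / e)"
      using law(1)[of "\<lambda>x. ce_loss (f x)", OF m] int[OF f] by simp
    show "(\<lambda>x. ce_loss (f x) k) \<in> borel_measurable PX" using m by simp
    show "AE x in PX. norm (ce_loss (f x) k) \<le> norm ((?u (g x) $ k * ce_loss (f x) k) / e)"
    proof (intro AE_I2)
      fix x assume "x \<in> space PX"
      then have "e \<le> ?u (g x) $ k" using ge[OF g(1)] by simp
      then have "e * \<bar>ce_loss (f x) k\<bar> \<le> ?u (g x) $ k * \<bar>ce_loss (f x) k\<bar>"
        by (intro mult_right_mono) auto
      then show "norm (ce_loss (f x) k) \<le> norm ((?u (g x) $ k * ce_loss (f x) k) / e)"
        using e(1) \<open>e \<le> ?u (g x) $ k\<close> by (simp add: abs_mult field_simps)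
    qed
  qed

  \<comment> \<open>The identity is written out to match the general lemma with \<open>u\<close> as
    the identity.\<close>
  have "minimizers ?D (backward_loss ?T) F = {f \<in> F. AE x in PX. (\<lambda>p. p) (f x) = (\<lambda>p. p) (g x)}"
  proof (rule minimizers_cross_entropy[where u = "\<lambda>p. p", OF g(1)])
    fix f assume f: "f \<in> F"
    have bm: "(\<lambda>x. backward_loss ?T (f x) j) \<in> borel_measurable MX" for j
      unfolding backward_loss_def using softmax_ce_loss_measurable[OF models[OF f]] by measurable
    have "integrable PX (\<lambda>x. backward_loss ?T (f x) j)" for j
      unfolding backward_loss_def using ce_int[OF f] by simp
    then have "risk ?D (backward_loss ?T) f =
        (LINT x|PX. (\<Sum>j\<in>UNIV. ?u (g x) $ j * backward_loss ?T (f x) j))"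
      unfolding risk_def using law(2)[of "\<lambda>x. backward_loss ?T (f x)", OF bm] qint by simp
    moreover have "(\<Sum>j\<in>UNIV. ?u (g x) $ j * backward_loss ?T (f x) j) =
        (\<Sum>k\<in>UNIV. g x $ k * ce_loss (f x) k)" for x
    proof -
      \<comment> \<open>Backward correction is unbiased: moving the matrix across the inner product
        lets it cancel against its inverse, which turns the noisy posterior back into the clean
        one.\<close>
      let ?c = "\<chi> k. ce_loss (f x) k"
      have "(\<Sum>j\<in>UNIV. ?u (g x) $ j * backward_loss ?T (f x) j) = ?u (g x) \<bullet> (matrix_inv ?T *v ?c)"
        by (simp add: inner_vec_def backward_loss_def matrix_vector_mult_def)
      also have "\<dots> = g x \<bullet> ((?T ** matrix_inv ?T) *v ?c)"
        by (simp add: matrix_vector_mul_assoc dot_lmul_matrix)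
      also have "\<dots> = (\<Sum>k\<in>UNIV. g x $ k * ce_loss (f x) k)"
        using matrix_inv_inverse(1)[OF inv] by (simp add: inner_vec_def)
      finally show ?thesis .
    qed
    ultimately show "risk ?D (backward_loss ?T) f =
        (LINT x|PX. (\<Sum>k\<in>UNIV. g x $ k * ce_loss (f x) k))" by simp
  qed (use ce_int PXm models in auto)
  then show "minimizers ?D (backward_loss ?T) F = {f \<in> F. AE x in PX. f x = g x}" .

  \<comment> \<open>The components of \<open>?u (f x)\<close> lie in [e, 1], so the loss lies
    between 0 and -ln e, and a bounded function is integrable for a probability measure.\<close>
  have uce_int: "integrable PX (\<lambda>x. ce_loss (?u (f x)) k)" if f: "f \<in> F" for f k
  proof (rule PX.integrable_const_bound)
    show "(\<lambda>x. ce_loss (?u (f x)) k) \<in> borel_measurable PX"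
      using softmax_ce_loss_measurable[OF sm[OF f]] by simp
    show "AE x in PX. norm (ce_loss (?u (f x)) k) \<le> - ln e"
    proof (intro AE_I2)
      fix x assume "x \<in> space PX"
      then have x: "x \<in> space MX" by simp
      have "ln e \<le> ln (?u (f x) $ k)" using ge[OF f x, of k] e(1) by (intro ln_mono) auto
      moreover have "ln (?u (f x) $ k) \<le> 0"
        using softmax_modelD(2,4)[OF sm[OF f] x] by simp
      ultimately show "norm (ce_loss (?u (f x)) k) \<le> - ln e" by (simp add: ce_loss_def)
    qed
  qed
  have "minimizers ?D (forward_loss ?T) F = {f \<in> F. AE x in PX. ?u (f x) = ?u (g x)}"
  proof (rule minimizers_cross_entropy[where u = ?u, OF g(1)])
    fix f assume f: "f \<in> F"
    show "risk ?D (forward_loss ?T) f = (LINT x|PX. (\<Sum>k\<in>UNIV. ?u (g x) $ k * ce_loss (?u (f x)) k))"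
      unfolding risk_def forward_loss_def transpose_matrix_vector
      using law(2)[of "\<lambda>x. ce_loss (?u (f x))", OF softmax_ce_loss_measurable[OF sm[OF f]]]
        qint[OF uce_int[OF f]] by simp
  qed (use uce_int PXm sm in auto)
  \<comment> \<open>Invertibility makes the transition injective on predictions, so equality of the
    noisy predictions transfers back to the models.\<close>
  moreover have "?u p = ?u p' \<longleftrightarrow> p = p'" for p p'
    by (metis inv matrix_inv_inverse(1) vector_matrix_mul_assoc vector_matrix_mul_rid)
  ultimately show "minimizers ?D (forward_loss ?T) F = {f \<in> F. AE x in PX. f x = g x}" by simp
qed

end

text \<open>The backward and the smoothed loss are the same function, so both infima and minimizers
  agree. If the clean posterior \<open>g\<close> is in \<open>F\<close>, the least backward risk is
  the expected entropy of \<open>g\<close> and the least forward risk that of the noisy posterior.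
  These values differ in general, so forward correction is compared through its minimizers.\<close>

theorem theorem5p2:
  fixes M :: "'w measure" and MX :: "'x measure" and X :: "'w \<Rightarrow> 'x"
    and Y Yt :: "'w \<Rightarrow> 2" and e0 e1 r_LC :: real
    and T :: "real ^ 2 ^ 2" and D :: "('x \<times> 2) measure"
    and F :: "('x \<Rightarrow> real ^ 2) set"
  assumes noise: "label_noise M MX X Y Yt e0 e1"
    and T_def: "T = noise_matrix e0 e1"
    and T_nonsingular: "invertible T"
    and D_def: "D = noisy_law M MX X Yt"
    and symmetric: "e1 - e0 = 0"
    and r_LC_def: "r_LC = 2 * e0 / (2 * e0 - 1)"
    and r_LC_neg: "r_LC < 0"
    and models: "\<And>f. f \<in> F \<Longrightarrow> softmax_model MX f"
    and expectations_exist: "\<And>f. f \<in> F \<Longrightarrow> integrable D (\<lambda>(x, y). ce_loss (f x) y)"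
  shows "(INF f\<in>F. risk D (backward_loss T) f) = (INF f\<in>F. risk D (gls_loss r_LC) f) \<and>
         minimizers D (backward_loss T) F = minimizers D (gls_loss r_LC) F \<and>
         ((\<exists>g\<in>F. clean_posterior M MX X Y g) \<longrightarrow>
           minimizers D (backward_loss T) F \<noteq> {} \<and>
           minimizers D (backward_loss T) F = minimizers D (forward_loss T) F \<and>
           minimizers D (forward_loss T) F = minimizers D (gls_loss r_LC) F)"
proof -
  interpret label_noise M MX X Y Yt e0 e1 by (rule noise)
  have e1: "e1 = e0" using symmetric by simp
  \<comment> \<open>With e0 \<ge> 0, a negative quotient forces a positive numerator and a negative
    denominator. The value 1/2 is excluded too, since division by 0 yields 0.\<close>
  have e0: "0 < e0" "e0 < 1 / 2"
    using r_LC_neg rates(1) unfolding r_LC_def by (auto simp: divide_less_0_iff)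
  have loss: "gls_loss r_LC = backward_loss T"
    using gls_loss_eq_backward_loss[OF _ r_LC_def] e0 by (simp add: T_def e1)
  have "minimizers D (backward_loss T) F \<noteq> {} \<and>
      minimizers D (backward_loss T) F = minimizers D (forward_loss T) F"
    if "g \<in> F" "clean_posterior M MX X Y g" for g
    using minimizers_symmetric_noise[OF e0 refl e1 models expectations_exist[unfolded D_def] that]
      T_nonsingular that(1) unfolding D_def T_def e1 by auto
  then show ?thesis by (auto simp: loss)
qed

end
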